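(* For every prime power $q$, the number $J_{\mathrm{GH}}(q)$ of distinct $j$-invariants of generalized Hessian curves over $\mathbb{F}_q$ is $$J_{\mathrm{GH}}(q)=\begin{cases}q-1,& q\equiv0\pmod3,\\ \lfloor (3q+1)/4\rfloor,& q\equiv1\pmod3,\\ \lfloor q/2\rfloor,& q\equiv2\pmod3.\end{cases}$$
   Context: For $u,v\in\mathbb{F}_q$ with $v\ne0$ and $u^3\ne27v$, the generalized Hessian curve $E_{\mathrm{GH},u,v}$ is the elliptic curve $X^3+Y^3+v=uXY$ over $\mathbb{F}_q$, with $j(E_{\mathrm{GH},u,v})=\frac1v\left(\frac{u(u^3+216v)}{u^3-27v}\right)^3$. $J_{\mathrm{GH}}(q)=\#\{j(E_{\mathrm{GH},u,v}): u,v\in\mathbb{F}_q,\ v\ne0,\ u^3\ne27v\}$. *)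

theory Defs
  imports Main
begin

definition j_GH :: "'a::field \<Rightarrow> 'a \<Rightarrow> 'a" where
  "j_GH u v = (1 / v) * ((u * (u ^ 3 + 216 * v)) / (u ^ 3 - 27 * v)) ^ 3"

definition J_GH :: "'a::{finite,field} itself \<Rightarrow> nat" where
  "J_GH TYPE('a) = card {j_GH u v | u v :: 'a. v \<noteq> 0 \<and> u ^ 3 \<noteq> 27 * v}"

end

(*
In characteristic 3, j = u^3 / v. Otherwise put s = u^3 / (27 v): then j runs through the values of
h(s) = 27 s (s + 8)^3 / (s - 1)^3 for s ~= 1. The curve h(s) = h(t), s ~= t, is rational, with
parametrisation s = c^3, t = ((c + 2) / (c - 1))^3, and s is a cube at every rational point of it.

If F_q has a primitive cube root of unity w, then the fibre of h through a non-cube is a single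
point, while the fibre through c^3 consists of c^3 and the values of ((x + 2) / (x - 1))^3 at
x = c, w c, w^2 c. These four points are distinct unless h(c^3) is 0 or 1728.
If F_q has none, then cubing is bijective and c |-> (c + 2) / (c - 1) is an involution whose orbits
are the fibres, except that its two fixed points, 1 + sqrt 3 and 1 - sqrt 3 when they exist, lie in
the same fibre, the one over 1728. Every fibre has two elements, except {0} in characteristic 2.

The residue of q mod 3 comes from the order-3 map x |-> -1 / (x + 1) on F_q - {0, -1}: its fixed
points are the roots of x^2 + x + 1, and their number is congruent to q - 2.
*)
theory Submission
  imports Defs
begin

section \<open>Counting by fibres and by orbits of length three\<close>

lemma card_eq_mult_card_image:
  assumes "finite A" "\<And>x. x \<in> A \<Longrightarrow> card {y \<in> A. f y = f x} = k"
  shows "card A = k * card (f ` A)"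
proof -
  have "card A = (\<Sum>x\<in>A. 1)" by simp
  also have "\<dots> = (\<Sum>z\<in>f ` A. \<Sum>x | x \<in> A \<and> f x = z. 1)"
    using sum.image_gen[OF assms(1), of "\<lambda>_. 1::nat" f] by simp
  also have "\<dots> = (\<Sum>z\<in>f ` A. k)"
    by (rule sum.cong) (auto simp: assms(2))
  finally show ?thesis by simp
qed

text \<open>Orbits have 1 or 3 elements, since \<open>f\<close> generates an action of the cyclic
  group of order 3.\<close>

lemma card_mod_3_eq_card_fixpoints:
  assumes fin: "finite A" and closed: "\<And>x. x \<in> A \<Longrightarrow> f x \<in> A"
    and f3: "\<And>x. x \<in> A \<Longrightarrow> f (f (f x)) = x"
  shows "card A mod 3 = card {x \<in> A. f x = x} mod 3"
proof -
  define B where "B = {x \<in> A. f x \<noteq> x}"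
  define orb where "orb x = {x, f x, f (f x)}" for x
  have fibre: "{y \<in> B. orb y = orb x} = orb x \<and> card (orb x) = 3" if "x \<in> B" for x
  proof -
    have x: "x \<in> A" "f x \<noteq> x" "f x \<in> A" "f (f x) \<in> A" "f (f (f x)) = x"
      using that closed f3 by (auto simp: B_def)
    have "f (f x) \<noteq> f x" "f (f x) \<noteq> x"
      using x by metis+
    moreover from this have "orb (f x) = orb x" "orb (f (f x)) = orb x"
      using x by (simp_all add: orb_def insert_commute)
    moreover have "y \<in> orb x" if "orb y = orb x" for y
      using that by (auto simp: orb_def)
    ultimately show ?thesis
      using x by (fastforce simp: orb_def B_def)
  qed
  have "card B = 3 * card (orb ` B)"
    using fin fibre by (intro card_eq_mult_card_image) (auto simp: B_def)
  moreover have "card A = card B + card {x \<in> A. f x = x}"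
    using fin by (subst card_Un_disjoint[symmetric]) (auto simp: B_def intro: arg_cong[of _ _ card])
  ultimately show ?thesis by simp
qed

text \<open>The map acts on \<open>q - 2\<close> points; \<open>q + 1\<close> is the same residue
  without truncated subtraction.\<close>

lemma card_mod_3_eq_card_roots:
  "(card (UNIV :: 'a::{finite,field} set) + 1) mod 3 = card {x::'a. x^2 + x + 1 = 0} mod 3"
proof -
  define f where "f x = - 1 / (x + 1)" for x :: 'a
  define A where "A = UNIV - {0, - 1 :: 'a}"
  have nz: "x + 1 \<noteq> 0" if "x \<noteq> - 1" for x :: 'a
    using that eq_neg_iff_add_eq_0 by blast
  have "card A mod 3 = card {x \<in> A. f x = x} mod 3"
  proof (rule card_mod_3_eq_card_fixpoints)
    show "finite A" by simp
  next
    fix x assume "x \<in> A"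
    then have x: "x \<noteq> 0" "x + 1 \<noteq> 0" using nz by (auto simp: A_def)
    show "f x \<in> A" using x by (auto simp: A_def f_def field_simps)
    have "f (f x) = - (x + 1) / x" using x by (simp add: f_def field_simps)
    then show "f (f (f x)) = x" using x by (simp add: f_def field_simps)
  qed
  moreover have "{x \<in> A. f x = x} = {x. x^2 + x + 1 = 0}"
  proof (intro set_eqI iffI; clarsimp)
    fix x :: 'a assume "x \<in> A" "f x = x"
    then have "x + 1 \<noteq> 0" "- 1 / (x + 1) = x" using nz by (auto simp: A_def f_def)
    then have "- 1 = x * (x + 1)" by (simp add: field_simps)
    then show "x^2 + x + 1 = 0" by algebra
  next
    fix x :: 'a assume *: "x^2 + x + 1 = 0"
    then have x: "x \<noteq> 0" "x \<noteq> - 1" by auto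
    have "- 1 = x * (x + 1)" using * by algebra
    then have "f x = x" using nz[OF x(2)] by (simp add: f_def field_simps)
    with x show "x \<in> A \<and> f x = x" by (simp add: A_def)
  qed
  moreover have "card (UNIV :: 'a set) = card A + 2"
  proof -
    have "card {0, - 1 :: 'a} = 2" by simp
    then show ?thesis
      using card_Un_disjoint[of A "{0, - 1 :: 'a}"] by (auto simp: A_def Un_commute)
  qed
  ultimately show ?thesis by simp
qed

section \<open>Reduction of the j-invariant to one parameter\<close>

lemma numeral_27_neq_0:
  assumes "(3::'a::field) \<noteq> 0"
  shows "(27::'a) \<noteq> 0"
proof -
  have "(27::'a) = 3 ^ 3" by simp
  then show ?thesis using assms by (metis power_not_zero)
qed

text \<open>\<open>j_GH\<close> in terms of \<open>s = u ^ 3 / (27 * v)\<close>.\<close>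

definition hess :: "'a::field \<Rightarrow> 'a" where
  "hess s = 27 * (s * (s + 8) ^ 3 / (s - 1) ^ 3)"

lemma j_GH_eq_hess:
  assumes "(3::'a::field) \<noteq> 0" "v \<noteq> 0" "u ^ 3 \<noteq> 27 * v"
  shows "j_GH u v = hess (u ^ 3 / (27 * v) :: 'a)"
proof -
  note n27 = numeral_27_neq_0[OF assms(1)]
  define s where "s = u ^ 3 / (27 * v)"
  have u: "u ^ 3 = 27 * v * s" using assms n27 by (simp add: s_def)
  have s1: "s \<noteq> 1" using assms u by auto
  have "j_GH u v = (1 / v) * (u ^ 3 * (u ^ 3 + 216 * v) ^ 3 / (u ^ 3 - 27 * v) ^ 3)"
    by (simp add: j_GH_def power_divide power_mult_distrib)
  also have "u ^ 3 + 216 * v = 27 * v * (s + 8)" unfolding u by algebra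
  also have "u ^ 3 - 27 * v = 27 * v * (s - 1)" unfolding u by algebra
  also have "(1 / v) * (u ^ 3 * (27 * v * (s + 8)) ^ 3 / (27 * v * (s - 1)) ^ 3) = hess s"
  proof -
    \<comment> \<open>The 27 inside the two cubes only has to cancel and is abstracted to
      \<open>k\<close>; the 27 outside them survives in \<open>hess\<close>.\<close>
    have "(1 / v) * (27 * v * s * (k * v * (s + 8)) ^ 3 / (k * v * (s - 1)) ^ 3) = hess s"
      if "k \<noteq> 0" for k
      using that assms(2) s1 by (simp add: hess_def power_mult_distrib)
    from this[OF n27] show ?thesis by (simp only: u)
  qed
  finally show ?thesis by (simp add: s_def)
qed

lemma j_GH_set_eq_hess_image:
  assumes "(3::'a::field) \<noteq> 0"
  shows "{j_GH u v | u v :: 'a. v \<noteq> 0 \<and> u ^ 3 \<noteq> 27 * v} = hess ` (UNIV - {1})"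
proof -
  note n27 = numeral_27_neq_0[OF assms(1)]
  show ?thesis
  proof (intro equalityI subsetI)
    fix j assume "j \<in> {j_GH u v | u v :: 'a. v \<noteq> 0 \<and> u ^ 3 \<noteq> 27 * v}"
    then obtain u v where "j = j_GH u v" "v \<noteq> 0" "u ^ 3 \<noteq> 27 * v" by auto
    then show "j \<in> hess ` (UNIV - {1})"
      using j_GH_eq_hess[OF assms] n27
      by (intro image_eqI[of _ _ "u ^ 3 / (27 * v)"]) auto
  next
    fix j :: 'a assume "j \<in> hess ` (UNIV - {1})"
    then obtain s where s: "j = hess s" "s \<noteq> 1" by auto
    have "\<exists>u v. v \<noteq> 0 \<and> u ^ 3 \<noteq> 27 * v \<and> s = u ^ 3 / (27 * v)"
    proof (cases "s = 0")
      case True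
      then show ?thesis using n27 by (intro exI[of _ 0] exI[of _ 1]) auto
    next
      case False
      \<comment> \<open>With \<open>u = 3\<close> the numerator is 27, so \<open>v = 1 / s\<close>
        returns \<open>s\<close>.\<close>
      then show ?thesis using n27 s(2)
        by (intro exI[of _ 3] exI[of _ "1 / s"]) (auto simp: field_simps)
    qed
    then show "j \<in> {j_GH u v | u v :: 'a. v \<noteq> 0 \<and> u ^ 3 \<noteq> 27 * v}"
      using j_GH_eq_hess[OF assms] s(1) by force
  qed
qed

section \<open>Characteristic 3\<close>

lemma J_GH_char_3:
  assumes "(3::'a::{finite,field}) = 0"
  shows "J_GH TYPE('a) = card (UNIV :: 'a set) - 1"
proof -
  have "(27::'a) = 3 * 9" "(216::'a) = 3 * 72" by simp_all
  then have z: "(27::'a) = 0" "(216::'a) = 0" using assms by (metis mult_zero_left)+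
  have "{j_GH u v | u v :: 'a. v \<noteq> 0 \<and> u ^ 3 \<noteq> 27 * v} = UNIV - {0}"
  proof (intro equalityI subsetI)
    fix j assume "j \<in> {j_GH u v | u v :: 'a. v \<noteq> 0 \<and> u ^ 3 \<noteq> 27 * v}"
    then show "j \<in> UNIV - {0}" by (auto simp: j_GH_def z)
  next
    fix j :: 'a assume "j \<in> UNIV - {0}"
    then have "j = j_GH 1 (1 / j)" "1 / j \<noteq> 0" by (auto simp: j_GH_def z)
    then show "j \<in> {j_GH u v | u v :: 'a. v \<noteq> 0 \<and> u ^ 3 \<noteq> 27 * v}"
      using z by (intro CollectI exI[of _ 1] exI[of _ "1 / j"]) auto
  qed
  then show ?thesis by (simp add: J_GH_def)
qed

section \<open>Coincidences between values of \<open>hess\<close>\<close>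

text \<open>The value at \<open>(s, t)\<close>, \<open>s = c ^ 3\<close>, is the norm
  \<open>(d + b * c + a * c^2) * (d + b * w * c + a * w^2 * c^2) * (d + b * w^2 * c + a * w * c^2)\<close>
  of \<open>d + b * c + a * c^2 = (c + 2) ^ 3 - t * (c - 1) ^ 3\<close>, where \<open>w\<close> is a
  primitive cube root of unity.\<close>

definition hess_norm :: "'a::field \<Rightarrow> 'a \<Rightarrow> 'a" where
  "hess_norm s t = (let a = 3 * (t + 2); b = 3 * (4 - t); d = s + 8 - t * (s - 1)
     in a ^ 3 * s ^ 2 + b ^ 3 * s + d ^ 3 - 3 * a * b * d * s)"

text \<open>Once denominators are cleared, the difference of the two sides is
  \<open>(t - s) * hess_norm s t\<close>.\<close>

lemma hess_eq_iff:
  fixes s t :: "'a::field"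
  assumes "(3::'a) \<noteq> 0" "s \<noteq> 1" "t \<noteq> 1"
  shows "hess s = hess t \<longleftrightarrow> s = t \<or> hess_norm s t = 0"
proof -
  note n27 = numeral_27_neq_0[OF assms(1)]
  have "hess s = hess t \<longleftrightarrow> s * (s + 8) ^ 3 / (s - 1) ^ 3 = t * (t + 8) ^ 3 / (t - 1) ^ 3"
    unfolding hess_def mult_cancel_left using n27 by (simp only: simp_thms)
  also have "\<dots> \<longleftrightarrow> s * (s + 8) ^ 3 * (t - 1) ^ 3 = t * (t + 8) ^ 3 * (s - 1) ^ 3"
    using assms by (simp add: frac_eq_eq)
  also have "\<dots> \<longleftrightarrow> s * (s + 8) ^ 3 * (t - 1) ^ 3 - t * (t + 8) ^ 3 * (s - 1) ^ 3 = 0"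
    by simp
  also have "s * (s + 8) ^ 3 * (t - 1) ^ 3 - t * (t + 8) ^ 3 * (s - 1) ^ 3 = (t - s) * hess_norm s t"
    unfolding hess_norm_def Let_def by algebra
  finally show ?thesis by auto
qed

text \<open>The expression is the resultant of \<open>x^3 - s\<close> and
  \<open>a * x^2 + b * x + d\<close>. If it vanishes, these share a root, and the proof writes a
  cube root of \<open>s\<close> rationally in the coefficients.\<close>

lemma cube_if_norm_eq_0:
  fixes a b d s :: "'a::field"
  assumes N: "a ^ 3 * s ^ 2 + b ^ 3 * s + d ^ 3 - 3 * a * b * d * s = 0"
    and nz: "a \<noteq> 0 \<or> b \<noteq> 0 \<or> d \<noteq> 0"
  shows "\<exists>c. s = c ^ 3"
proof (cases "a * d = b ^ 2")
  case True
  \<comment> \<open>This is \<open>N\<close> multiplied by \<open>a ^ 3\<close>, with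
    \<open>a * d\<close> replaced by \<open>b ^ 2\<close>.\<close>
  have "(a ^ 3 * s - b ^ 3) ^ 2 = 0" using N True by algebra
  then have eq: "a ^ 3 * s = b ^ 3" by simp
  have "a \<noteq> 0"
  proof
    assume "a = 0"
    then have "b = 0" using True by simp
    with \<open>a = 0\<close> N nz show False by simp
  qed
  then have "s = (b / a) ^ 3" using eq by (simp add: power_divide field_simps)
  then show ?thesis ..
next
  case False
  \<comment> \<open>Dividing \<open>a^2 * (x^3 - s)\<close> by the quadratic leaves the remainder
    \<open>(b^2 - a * d) * x + b * d - a^2 * s\<close>; its root is the witness.\<close>
  have "(b * d - a ^ 2 * s) ^ 3 = s * (a * d - b ^ 2) ^ 3" using N by algebra
  then have "s = ((b * d - a ^ 2 * s) / (a * d - b ^ 2)) ^ 3"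
    using False by (simp add: power_divide field_simps)
  then show ?thesis ..
qed

lemma cube_if_hess_eq:
  fixes s t :: "'a::field"
  assumes "(3::'a) \<noteq> 0" "s \<noteq> 1" "t \<noteq> 1" "hess s = hess t" "s \<noteq> t"
  shows "\<exists>c. s = c ^ 3"
proof (cases "t + 2 = 0 \<and> 4 - t = 0 \<and> s + 8 - t * (s - 1) = 0")
  case True
  \<comment> \<open>If all three coefficients vanish, the norm says nothing about \<open>s\<close>.
    But then 6 = 0, so the characteristic is 2 and \<open>s = 0\<close>.\<close>
  then have t: "t = - 2" "t = 4" by (auto simp: eq_neg_iff_add_eq_0)
  have "3 * (2::'a) = 4 - (- 2)" by simp
  also have "\<dots> = 0" using t by (metis eq_iff_diff_eq_0)
  finally have "3 * (2::'a) = 0" .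
  then have two: "(2::'a) = 0" using assms(1) by (metis mult_eq_0_iff)
  have "s + 8 = 0" using True t(1) two by simp
  moreover have "(8::'a) = 2 * 4" by simp
  ultimately have "s = 0 ^ 3" using two by simp
  then show ?thesis ..
next
  case False
  have "hess_norm s t = 0" using assms hess_eq_iff by blast
  moreover have "3 * (t + 2) \<noteq> 0 \<or> 3 * (4 - t) \<noteq> 0 \<or> s + 8 - t * (s - 1) \<noteq> 0"
    using False assms(1) by (metis mult_eq_0_iff)
  ultimately show ?thesis
    unfolding hess_norm_def Let_def by (rule cube_if_norm_eq_0)
qed

lemma hess_eq_0_iff:
  fixes s :: "'a::field"
  assumes "(3::'a) \<noteq> 0" "s \<noteq> 1"
  shows "hess s = 0 \<longleftrightarrow> s = 0 \<or> s = - 8"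
proof -
  show ?thesis using assms numeral_27_neq_0 by (auto simp: hess_def eq_neg_iff_add_eq_0)
qed

text \<open>As 1728 = 27 * 64, the numerator of \<open>hess s - 1728\<close> is 27 times the square
  of this quadratic.\<close>

lemma hess_eq_1728_iff:
  fixes s :: "'a::field"
  assumes "(3::'a) \<noteq> 0" "s \<noteq> 1"
  shows "hess s = 1728 \<longleftrightarrow> s ^ 2 - 20 * s - 8 = 0"
proof -
  note n27 = numeral_27_neq_0[OF assms(1)]
  have "hess s - 1728 = 27 * (s ^ 2 - 20 * s - 8) ^ 2 / (s - 1) ^ 3"
  proof -
    have "hess s - 1728 = 27 * (s * (s + 8) ^ 3 - 64 * (s - 1) ^ 3) / (s - 1) ^ 3"
      using assms(2) by (simp add: hess_def diff_divide_distrib right_diff_distrib)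
    also have "s * (s + 8) ^ 3 - 64 * (s - 1) ^ 3 = (s ^ 2 - 20 * s - 8) ^ 2" by algebra
    finally show ?thesis .
  qed
  then have "hess s - 1728 = 0 \<longleftrightarrow> s ^ 2 - 20 * s - 8 = 0" using n27 assms(2) by simp
  then show ?thesis by simp
qed


section \<open>The parametrisation of the coincidence curve\<close>

text \<open>The involution inside the cube and multiplication by a primitive cube root of unity
  generate the tetrahedral group of the Hesse pencil.\<close>

definition isog :: "'a::field \<Rightarrow> 'a" where
  "isog c = ((c + 2) / (c - 1)) ^ 3"

lemma eq_isog_iff:
  assumes "c ^ 3 \<noteq> (1::'a::field)"
  shows "(c + 2) ^ 3 - t * (c - 1) ^ 3 = 0 \<longleftrightarrow> t = isog c"
proof -
  have "c - 1 \<noteq> 0" using assms by auto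
  then show ?thesis by (auto simp: isog_def power_divide divide_simps)
qed

lemma isog_neq_1:
  assumes "(3::'a::field) \<noteq> 0" "c ^ 3 \<noteq> (1::'a)"
  shows "isog c \<noteq> 1"
proof
  assume "isog c = 1"
  then have "(c + 2) ^ 3 - 1 * (c - 1) ^ 3 = 0" using eq_isog_iff[OF assms(2)] by metis
  \<comment> \<open>The difference of cubes is \<open>9 * (c^2 + c + 1)\<close>; multiply it by
    \<open>c - 1\<close>.\<close>
  then have "3 * 3 * (c ^ 3 - 1) = 0" by algebra
  then show False using assms by (metis mult_eq_0_iff right_minus_eq)
qed

section \<open>Fibres in the presence of a primitive cube root of unity\<close>

text \<open>Equal cubes mean that \<open>c * (c - 1)\<close> is \<open>c + 2\<close> times 1,
  \<open>w\<close> or \<open>w^2\<close>. The first case is the quadratic leading to 1728; the other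
  two quadratics split and give \<open>c ^ 3 = 1\<close> or \<open>c ^ 3 = - 8\<close>.\<close>

lemma isog_eq_self:
  fixes c w :: "'a::field"
  assumes w: "w ^ 2 + w + 1 = 0" and c: "c ^ 3 \<noteq> 1" and eq: "isog c = c ^ 3"
  shows "c ^ 3 = - 8 \<or> (c ^ 3) ^ 2 - 20 * c ^ 3 - 8 = 0"
proof -
  have "(c + 2) ^ 3 - c ^ 3 * (c - 1) ^ 3 = 0" using eq_isog_iff[OF c] eq by metis
  moreover have "(c * (c - 1)) ^ 3 - (c + 2) ^ 3
      = (c ^ 2 - 2 * c - 2) * (c - w ^ 2) * (c + 2 * w ^ 2) * (c - w) * (c + 2 * w)"
    using w by algebra
  ultimately have "(c ^ 2 - 2 * c - 2) * (c - w ^ 2) * (c + 2 * w ^ 2) * (c - w) * (c + 2 * w) = 0"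
    by (simp add: power_mult_distrib)
  then consider "c ^ 2 - 2 * c - 2 = 0" | "c - w ^ 2 = 0" | "c + 2 * w ^ 2 = 0"
    | "c - w = 0" | "c + 2 * w = 0" by auto
  then show ?thesis
  proof cases
    case 1 then have "(c ^ 3) ^ 2 - 20 * c ^ 3 - 8 = 0" by algebra
    then show ?thesis ..
  next
    case 2 then have "c ^ 3 = 1" using w by algebra
    with c show ?thesis by simp
  next
    case 3 then have "c ^ 3 = - 8" using w by algebra
    then show ?thesis ..
  next
    case 4 then have "c ^ 3 = 1" using w by algebra
    with c show ?thesis by simp
  next
    case 5 then have "c ^ 3 = - 8" using w by algebra
    then show ?thesis ..
  qed
qed

lemma isog_eq_isog:
  fixes c w :: "'a::field"
  assumes n3: "(3::'a) \<noteq> 0" and w: "w ^ 2 + w + 1 = 0" and c: "c ^ 3 \<noteq> 1"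
    and eq: "isog c = isog (w * c)"
  shows "c = 0 \<or> c ^ 3 = - 8 \<or> (c ^ 3) ^ 2 - 20 * c ^ 3 - 8 = 0"
proof -
  have w3: "w ^ 3 = 1" using w by algebra
  have w0: "w \<noteq> 0" using w by auto
  have w1: "w \<noteq> 1" using n3 w by auto
  have c': "(w * c) ^ 3 \<noteq> 1" using c w3 by (simp add: power_mult_distrib)
  have "(c + 2) ^ 3 - isog c * (c - 1) ^ 3 = 0" "(w * c + 2) ^ 3 - isog c * (w * c - 1) ^ 3 = 0"
    using eq_isog_iff[OF c] eq_isog_iff[OF c'] eq by metis+
  then have "((c + 2) * (w * c - 1)) ^ 3 - ((w * c + 2) * (c - 1)) ^ 3 = 0"
    by algebra
  moreover have "((c + 2) * (w * c - 1)) ^ 3 - ((w * c + 2) * (c - 1)) ^ 3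
      = - 3 * (w - 1) ^ 3 * w * (c * (c - w) * (c + 2 * w) * (c ^ 2 - 2 * w * c - 2 * w ^ 2))"
    using w by algebra
  ultimately have "c * (c - w) * (c + 2 * w) * (c ^ 2 - 2 * w * c - 2 * w ^ 2) = 0"
    using n3 w0 w1 by simp
  then consider "c = 0" | "c - w = 0" | "c + 2 * w = 0" | "c ^ 2 - 2 * w * c - 2 * w ^ 2 = 0"
    by auto
  then show ?thesis
  proof cases
    case 1 then show ?thesis by simp
  next
    case 2 then have "c ^ 3 = 1" using w by algebra
    with c show ?thesis by simp
  next
    case 3 then have "c ^ 3 = - 8" using w by algebra
    then show ?thesis by simp
  next
    \<comment> \<open>The quadratic is \<open>w^2\<close> times \<open>x^2 - 2 * x - 2\<close> at
      \<open>x = c / w\<close>, and \<open>x^3 = c^3\<close>.\<close>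
    case 4 then have "(c ^ 3) ^ 2 - 20 * c ^ 3 - 8 = 0" using w by algebra
    then show ?thesis by simp
  qed
qed

text \<open>With \<open>w\<close> in the field the norm splits into three factors linear in
  \<open>t\<close>, one for each cube root of \<open>c ^ 3\<close>.\<close>

lemma hess_fibre_cube:
  fixes c w :: "'a::field"
  assumes n3: "(3::'a) \<noteq> 0" and w: "w ^ 2 + w + 1 = 0" and c: "c ^ 3 \<noteq> 1"
  shows "{t. t \<noteq> 1 \<and> hess t = hess (c ^ 3)} = {c ^ 3, isog c, isog (w * c), isog (w ^ 2 * c)}"
proof -
  have "(w * c) ^ 3 = c ^ 3" "(w ^ 2 * c) ^ 3 = c ^ 3" using w by algebra+
  then have c': "(w * c) ^ 3 \<noteq> 1" "(w ^ 2 * c) ^ 3 \<noteq> 1" using c by simp_all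
  have norm: "hess_norm (c ^ 3) t = ((c + 2) ^ 3 - t * (c - 1) ^ 3)
    * ((w * c + 2) ^ 3 - t * (w * c - 1) ^ 3) * ((w ^ 2 * c + 2) ^ 3 - t * (w ^ 2 * c - 1) ^ 3)" for t
    using w unfolding hess_norm_def Let_def by algebra
  have "hess_norm (c ^ 3) t = 0 \<longleftrightarrow> t = isog c \<or> t = isog (w * c) \<or> t = isog (w ^ 2 * c)" for t
    unfolding norm mult_eq_0_iff
      eq_isog_iff[OF c] eq_isog_iff[OF c'(1)] eq_isog_iff[OF c'(2)] by blast
  then have eq: "hess t = hess (c ^ 3) \<longleftrightarrow> t = c ^ 3 \<or> t = isog c \<or> t = isog (w * c) \<or> t = isog (w ^ 2 * c)"
    if "t \<noteq> 1" for t
    using hess_eq_iff[OF n3 c that] by metis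
  have "t \<noteq> 1" if "t = c ^ 3 \<or> t = isog c \<or> t = isog (w * c) \<or> t = isog (w ^ 2 * c)" for t
    using that c isog_neq_1[OF n3 c] isog_neq_1[OF n3 c'(1)] isog_neq_1[OF n3 c'(2)] by metis
  with eq show ?thesis
    by (intro set_eqI) (unfold mem_Collect_eq insert_iff empty_iff, metis)
qed

lemma card_hess_fibre_cube:
  fixes c w :: "'a::field"
  assumes n3: "(3::'a) \<noteq> 0" and w: "w ^ 2 + w + 1 = 0" and c: "c ^ 3 \<noteq> 1"
    and gen: "hess (c ^ 3) \<noteq> 0" "hess (c ^ 3) \<noteq> 1728"
  shows "card {t. t \<noteq> 1 \<and> hess t = hess (c ^ 3)} = 4"
proof -
  have w3: "w ^ 3 = 1" using w by algebra
  \<comment> \<open>\<open>P\<close> is stable under multiplication by \<open>w\<close>, so the two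
    coincidence lemmas, applied at \<open>c\<close>, \<open>w * c\<close> and
    \<open>w^2 * c\<close>, separate all six pairs.\<close>
  define P where "P x \<longleftrightarrow> x \<noteq> 0 \<and> x ^ 3 \<noteq> 1 \<and> x ^ 3 \<noteq> - 8 \<and> (x ^ 3) ^ 2 - 20 * x ^ 3 - 8 \<noteq> 0"
    for x :: 'a
  have P: "P c"
    using gen hess_eq_0_iff[OF n3 c] hess_eq_1728_iff[OF n3 c] c by (auto simp: P_def)
  have Pw: "P (w * x)" if "P x" for x
  proof -
    have "w \<noteq> 0" "(w * x) ^ 3 = x ^ 3" using w w3 by (auto simp: power_mult_distrib)
    with that show ?thesis by (simp only: P_def mult_eq_0_iff simp_thms)
  qed
  have self: "isog x \<noteq> x ^ 3" if "P x" for x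
    using isog_eq_self[OF w, of x] that unfolding P_def by blast
  have shift: "isog x \<noteq> isog (w * x)" if "P x" for x
    using isog_eq_isog[OF n3 w, of x] that unfolding P_def by blast
  have eqs: "(w * c) ^ 3 = c ^ 3" "(w * (w * c)) ^ 3 = c ^ 3" "w * (w * (w * c)) = c"
    using w3 by algebra+
  have "isog c \<noteq> c ^ 3" "isog (w * c) \<noteq> c ^ 3" "isog (w * (w * c)) \<noteq> c ^ 3"
    "isog c \<noteq> isog (w * c)" "isog (w * c) \<noteq> isog (w * (w * c))" "isog (w * (w * c)) \<noteq> isog c"
    using self[OF P] self[OF Pw[OF P]] self[OF Pw[OF Pw[OF P]]]
      shift[OF P] shift[OF Pw[OF P]] shift[OF Pw[OF Pw[OF P]]] unfolding eqs by metis+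
  then show ?thesis
    unfolding hess_fibre_cube[OF n3 w c] power2_eq_square mult.assoc by simp
qed

section \<open>Counting values when a primitive cube root of unity exists\<close>

lemma card_hess_image_if_root:
  fixes w :: "'a::{finite,field}"
  assumes n3: "(3::'a) \<noteq> 0" and w: "w ^ 2 + w + 1 = 0"
  shows "card (hess ` (UNIV - {1::'a})) = (3 * card (UNIV :: 'a set) + 1) div 4"
proof -
  have w3: "w ^ 3 = 1" using w by algebra
  have w0: "w \<noteq> 0" using w by auto
  have w1: "w \<noteq> 1" using n3 w by auto
  have n9: "(9::'a) \<noteq> 0"
  proof -
    have "(9::'a) = 3 * 3" by simp
    with n3 show ?thesis by (metis mult_eq_0_iff)
  qed
  define Q where "Q = range (\<lambda>c::'a. c ^ 3)"
  \<comment> \<open>There are \<open>m\<close> nonzero cubes; adding 0 and removing the pole 1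
    leaves \<open>m\<close> again.\<close>
  define C where "C = Q - {1}"
  define m where "m = card ((\<lambda>c::'a. c ^ 3) ` (UNIV - {0}))"
  have "card (UNIV - {0::'a}) = 3 * m"
    unfolding m_def
  proof (rule card_eq_mult_card_image)
    fix x :: 'a assume "x \<in> UNIV - {0}"
    then have x: "x \<noteq> 0" by simp
    have "y ^ 3 = x ^ 3 \<longleftrightarrow> y = x \<or> y = w * x \<or> y = w ^ 2 * x" for y
    proof -
      have "y ^ 3 - x ^ 3 = (y - x) * (y - w * x) * (y - w ^ 2 * x)" using w by algebra
      then show ?thesis by (metis eq_iff_diff_eq_0 mult_eq_0_iff)
    qed
    then have "{y \<in> UNIV - {0}. y ^ 3 = x ^ 3} = {x, w * x, w ^ 2 * x}"
      using x w0 by auto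
    moreover have "w ^ 2 \<noteq> 1" "w ^ 2 \<noteq> w"
      using w3 w1 w0 by (auto simp: power2_eq_square power3_eq_cube)
    ultimately show "card {y \<in> UNIV - {0}. y ^ 3 = x ^ 3} = 3"
      using x w1 by auto
  qed simp
  then have q: "card (UNIV :: 'a set) = 3 * m + 1"
    using card_Suc_Diff1[of "UNIV :: 'a set" 0] by simp
  have Q0: "Q = insert 0 ((\<lambda>c::'a. c ^ 3) ` (UNIV - {0}))"
    using image_insert[of "\<lambda>c::'a. c ^ 3" 0 "UNIV - {0}"]
    by (simp only: Q_def insert_Diff[OF UNIV_I] power_zero_numeral)
  have cardQ: "card Q = m + 1"
    unfolding Q0 m_def by (subst card_insert_disjoint) auto
  have "1 \<in> Q" unfolding Q_def by (rule range_eqI[of _ _ 1]) simp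
  then have cardC: "card C = m" using cardQ by (simp add: C_def)
  have "card (- Q) = 2 * m" using cardQ q by (simp add: Compl_eq_Diff_UNIV card_Diff_subset)
  have S: "UNIV - {1} = - Q \<union> C" using \<open>1 \<in> Q\<close> by (auto simp: C_def)
  have cube: "s \<in> Q" if "s \<noteq> 1" "t \<noteq> 1" "hess s = hess t" "s \<noteq> t" for s t
    using cube_if_hess_eq[OF n3 that] by (auto simp: Q_def)
  have "inj_on hess (- Q)"
    using \<open>1 \<in> Q\<close> cube by (intro inj_onI) (metis ComplD)
  then have card_noncubes: "card (hess ` (- Q)) = 2 * m"
    using \<open>card (- Q) = 2 * m\<close> by (simp add: card_image)
  have "hess ` (- Q) \<inter> hess ` C = {}"
    using \<open>1 \<in> Q\<close> cube by (auto simp: C_def) (metis ComplD)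
  then have J: "card (hess ` (UNIV - {1::'a})) = 2 * m + card (hess ` C)"
    unfolding S image_Un using card_noncubes by (subst card_Un_disjoint) auto
  define Z where "Z = {s \<in> C. hess s = 0 \<or> hess s = 1728}"
  define R where "R = C - Z"
  define n where "n = card (hess ` R)"
  have cardR: "card R = 4 * n"
    unfolding n_def
  proof (rule card_eq_mult_card_image)
    fix s assume s: "s \<in> R"
    then obtain c where c: "s = c ^ 3" "c ^ 3 \<noteq> 1" "hess (c ^ 3) \<noteq> 0" "hess (c ^ 3) \<noteq> 1728"
      by (auto simp: R_def C_def Q_def Z_def)
    have "t \<in> Q" if "t \<noteq> 1" "hess t = hess s" for t
      using cube[of t s] that c by (cases "t = s") (auto simp: Q_def)
    then have "{t \<in> R. hess t = hess s} = {t. t \<noteq> 1 \<and> hess t = hess (c ^ 3)}"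
      using c by (auto simp: R_def C_def Z_def)
    then show "card {t \<in> R. hess t = hess s} = 4"
      using card_hess_fibre_cube[OF n3 w c(2-4)] by simp
  qed simp
  have "C = Z \<union> R" "Z \<inter> R = {}" "hess ` Z \<inter> hess ` R = {}"
    by (auto simp: R_def Z_def)
  then have m: "m = card Z + 4 * n" and JC: "card (hess ` C) = card (hess ` Z) + n"
    using cardC cardR by (auto simp: card_Un_disjoint image_Un n_def)
  have C: "s \<noteq> 1" if "s \<in> C" for s using that by (simp add: C_def)
  have "0 \<in> C" "- 8 \<in> C"
  proof -
    have "0 \<in> Q" using Q0 by simp
    moreover have "- 8 \<in> Q" unfolding Q_def by (rule range_eqI[of _ _ "- 2"]) simp
    moreover have "- 8 \<noteq> (1::'a)"
    proof
      assume "- 8 = (1::'a)"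
      then have "1 - (- 8) = (0::'a)" by simp
      then show False using n9 by simp
    qed
    ultimately show "0 \<in> C" "- 8 \<in> C" by (auto simp: C_def)
  qed
  \<comment> \<open>In characteristic 2 the values 0 and 1728 agree and only 0 lies over them.
    Otherwise 0 and -8 lie over 0, and either none or two points lie over 1728.\<close>
  have "card Z = 1 \<and> card (hess ` Z) = 1 \<or> card Z = 2 \<and> card (hess ` Z) = 1
    \<or> card Z = 4 \<and> card (hess ` Z) = 2"
  proof (cases "(2::'a) = 0")
    case True
    have "(8::'a) = 2 * 4" "(20::'a) = 2 * 10" by simp_all
    then have "(8::'a) = 0" "(20::'a) = 0" using True by (metis mult_zero_left)+
    then have "Z = {0}"
      using hess_eq_0_iff[OF n3 C] hess_eq_1728_iff[OF n3 C] \<open>0 \<in> C\<close> by (auto simp: Z_def)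
    then show ?thesis by simp
  next
    case False
    have "(8::'a) = 2 ^ 3" "(1728::'a) = 2 ^ 6 * 3 ^ 3" "(432::'a) = 2 ^ 4 * 3 ^ 3" by simp_all
    then have n: "(8::'a) \<noteq> 0" "(1728::'a) \<noteq> 0" "(432::'a) \<noteq> 0"
      using False n3 by (metis mult_eq_0_iff power_not_zero)+
    define Z1 where "Z1 = {s \<in> C. hess s = 1728}"
    have zero: "{s \<in> C. hess s = 0} = {0, - 8}"
      using hess_eq_0_iff[OF n3 C] \<open>0 \<in> C\<close> \<open>- 8 \<in> C\<close> by auto
    then have Z: "Z = {0, - 8} \<union> Z1" by (auto simp: Z_def Z1_def)
    have hZ: "hess ` {0, - 8 :: 'a} = {0}" unfolding zero[symmetric] using \<open>0 \<in> C\<close> zero by force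
    have disj: "{0, - 8} \<inter> Z1 = {}" using hZ n(2) by (auto simp: Z1_def)
    have card2: "card {0, - 8 :: 'a} = 2" using n(1) by simp
    show ?thesis
    proof (cases "Z1 = {}")
      case True
      then show ?thesis using Z hZ card2 by simp
    next
      case False
      then obtain s where s: "s \<in> C" "hess s = 1728" by (auto simp: Z1_def)
      have sq: "s ^ 2 - 20 * s - 8 = 0" using hess_eq_1728_iff[OF n3 C[OF s(1)]] s by simp
      \<comment> \<open>By Vieta \<open>20 - s\<close> is the second root; it is not 1 because the
        quadratic takes the value -27 there.\<close>
      have "20 - s \<noteq> 1"
      proof
        assume "20 - s = 1"
        then have "s - 19 = 0" by algebra
        moreover have "s ^ 2 - 20 * s - 8 + 3 * 9 = (s - 19) * (s - 1)" by algebra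
        ultimately have "3 * 9 = (0::'a)" using sq by (metis add_0 mult_zero_left)
        then show False using n3 n9 by (metis mult_eq_0_iff)
      qed
      have "(20 - s) ^ 2 - 20 * (20 - s) - 8 = 0" using sq by algebra
      then have s': "hess (20 - s) = 1728"
        using hess_eq_1728_iff[OF n3 \<open>20 - s \<noteq> 1\<close>] by simp
      have ne: "20 - s \<noteq> s"
      proof
        assume "20 - s = s"
        \<comment> \<open>432 is the discriminant of the quadratic.\<close>
        moreover have "4 * (s ^ 2 - 20 * s - 8) + 432 = (20 - s - s) ^ 2" by algebra
        ultimately have "(432::'a) = 0" using sq by simp
        with n(3) show False ..
      qed
      have "20 - s \<in> C"
        using cube[of "20 - s" s] ne s s' \<open>20 - s \<noteq> 1\<close> C by (simp add: C_def)
      moreover have "t = s \<or> t = 20 - s" if "t \<in> Z1" for t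
      proof -
        have "t ^ 2 - 20 * t - 8 = 0"
          using that hess_eq_1728_iff[OF n3 C, of t] by (simp add: Z1_def)
        then have "(t - s) * (t - (20 - s)) = 0" using sq by algebra
        then show ?thesis by auto
      qed
      ultimately have Z1: "Z1 = {s, 20 - s}" using s s' by (auto simp: Z1_def)
      have "card Z = 4"
        unfolding Z using disj card2 ne Z1 by (subst card_Un_disjoint) auto
      moreover have "hess ` Z = {0, 1728}"
        unfolding Z image_Un hZ Z1 using s s' by auto
      ultimately show ?thesis using n(2) by simp
    qed
  qed
  then show ?thesis using q J JC m by auto
qed

section \<open>Counting values when no primitive cube root of unity exists\<close>

lemma card_hess_image_if_no_root:
  assumes no_root: "\<And>w::'a::{finite,field}. w ^ 2 + w + 1 \<noteq> 0"
  shows "card (hess ` (UNIV - {1::'a})) = card (UNIV :: 'a set) div 2"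
proof -
  have n3: "(3::'a) \<noteq> 0" using no_root[of 1] by simp
  have aniso: "y = 0" if "x ^ 2 + x * y + y ^ 2 = 0" for x y :: 'a
  proof (rule ccontr)
    assume "y \<noteq> 0"
    then have "(x / y) ^ 2 + x / y + 1 = 0"
      using that by (simp add: field_simps power2_eq_square)
    with no_root show False by blast
  qed
  have cube_inj: "x = y" if "x ^ 3 = y ^ 3" for x y :: 'a
  proof (cases "y = 0")
    case False
    have "(x - y) * (x ^ 2 + x * y + y ^ 2) = 0" using that by algebra
    then show ?thesis using aniso[of x y] False by auto
  qed (use that in simp)
  then have "surj (\<lambda>c::'a. c ^ 3)" by (intro finite_UNIV_inj_surj injI) auto
  then have cube: "\<exists>c. s = c ^ 3" for s :: 'a by (metis surjD)
  have n1: "c ^ 3 \<noteq> 1 \<longleftrightarrow> c \<noteq> 1" for c :: 'a using cube_inj[of c 1] by auto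
  \<comment> \<open>At a fixed point of the involution \<open>isog c\<close> is \<open>c ^ 3\<close>
    itself; the partner is then the cube of the other fixed point, \<open>2 - c\<close> by
    Vieta.\<close>
  define conj where "conj c = (if c ^ 2 - 2 * c - 2 = 0 then (2 - c) ^ 3 else isog c)" for c :: 'a
  have fibre: "{t. t \<noteq> 1 \<and> hess t = hess (c ^ 3)} = {c ^ 3, conj c}" if "c \<noteq> 1" for c :: 'a
  proof -
    have c3: "c ^ 3 \<noteq> 1" using that n1 by simp
    \<comment> \<open>For \<open>w\<close> in the quadratic extension,
      \<open>isog (w * c) = ((a - b * w) / A) ^ 3\<close>. Hence
      \<open>t * A ^ 3 - (a - b * w) ^ 3 = X t + Y * w\<close>, whose norm
      \<open>X^2 - X * Y + Y^2\<close> replaces the two conjugate factors of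
      \<open>hess_norm\<close> and is anisotropic over the base field.\<close>
    define a b where "a = c ^ 2 - 2 * c - 2" and "b = 3 * c"
    define A where "A = c ^ 2 + c + 1"
    define X Y where "X t = t * A ^ 3 - (a ^ 3 - b ^ 3 - 3 * a * b ^ 2)" and "Y = 3 * a * b * (a + b)" for t
    have A: "A \<noteq> 0" using no_root by (simp add: A_def)
    have norm: "hess_norm (c ^ 3) t * A ^ 3 = ((c + 2) ^ 3 - t * (c - 1) ^ 3) * (X t ^ 2 + X t * (- Y) + (- Y) ^ 2)" for t
      unfolding X_def Y_def A_def a_def b_def hess_norm_def Let_def by algebra
    have "t = c ^ 3 \<or> t = conj c" if t: "t \<noteq> 1" "hess t = hess (c ^ 3)" for t
    proof (rule ccontr)
      assume "\<not> ?thesis"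
      then have ne: "t \<noteq> c ^ 3" "t \<noteq> conj c" by auto
      then have N0: "hess_norm (c ^ 3) t = 0" using hess_eq_iff[OF n3 c3 t(1)] t(2) by metis
      show False
      proof (cases "t = isog c")
        case False
        then have "X t ^ 2 + X t * (- Y) + (- Y) ^ 2 = 0"
          using norm[of t] N0 eq_isog_iff[OF c3, of t] by simp
        moreover from this have Y: "Y = 0" using aniso[of "X t" "- Y"] by simp
        ultimately have X: "X t = 0" by simp
        \<comment> \<open>Here \<open>a + b = (c + 2) * (c - 1)\<close>. The cases below give
          \<open>t = (2 - c) ^ 3\<close>, \<open>t = isog c\<close> and
          \<open>t = c ^ 3\<close>.\<close>
        have "a * c * (c + 2) * (c - 1) = 0"
        proof -
          have "3 * 3 * (a * c * (c + 2) * (c - 1)) = 0" using Y unfolding Y_def a_def b_def by algebra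
          then show ?thesis using n3 by (metis mult_eq_0_iff)
        qed
        then consider "a = 0" | "c = 0" | "c + 2 = 0" using that \<open>c \<noteq> 1\<close> by auto
        then show False
        proof cases
          case 1
          then have "A ^ 3 * (t - (2 - c) ^ 3) = 0"
            using X unfolding X_def a_def b_def A_def by algebra
          with A 1 ne(2) show False by (simp add: conj_def a_def)
        next
          case 2
          then have "t = isog c" using X by (simp add: X_def a_def b_def A_def isog_def eq_neg_iff_add_eq_0)
          with False show False ..
        next
          case 3
          then have c: "c = - 2" by (simp add: eq_neg_iff_add_eq_0)
          have "3 * 3 * 3 * (t - c ^ 3) = 0" using X unfolding X_def a_def b_def A_def c by algebra
          then show False using n3 ne(1) by (metis mult_eq_0_iff eq_iff_diff_eq_0)
        qed
      next
        case True
        then have a: "c ^ 2 - 2 * c - 2 = 0" using ne(2) unfolding conj_def by metis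
        have "(c + 2) ^ 3 - t * (c - 1) ^ 3 = 0" using True eq_isog_iff[OF c3] by blast
        then have "(t - c ^ 3) * (c - 1) ^ 3 = 0" using a by algebra
        then show False using ne(1) \<open>c \<noteq> 1\<close> by simp
      qed
    qed
    moreover have "conj c \<noteq> 1 \<and> hess (conj c) = hess (c ^ 3)"
    proof (cases "c ^ 2 - 2 * c - 2 = 0")
      case True
      have "2 - c \<noteq> 1" using \<open>c \<noteq> 1\<close> by (auto simp: algebra_simps)
      then have d: "(2 - c) ^ 3 \<noteq> 1" using n1 by blast
      have "(c ^ 3) ^ 2 - 20 * c ^ 3 - 8 = 0" "((2 - c) ^ 3) ^ 2 - 20 * (2 - c) ^ 3 - 8 = 0"
        using True by algebra+
      then have "hess (c ^ 3) = 1728" "hess ((2 - c) ^ 3) = 1728"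
        using hess_eq_1728_iff[OF n3 c3] hess_eq_1728_iff[OF n3 d] by auto
      then show ?thesis using True d by (simp add: conj_def)
    next
      case False
      have 1: "isog c \<noteq> 1" by (rule isog_neq_1[OF n3 c3])
      have "hess_norm (c ^ 3) (isog c) * A ^ 3 = 0"
        unfolding norm using eq_isog_iff[OF c3, of "isog c"] by simp
      then have "hess_norm (c ^ 3) (isog c) = 0" using A by simp
      then have "hess (c ^ 3) = hess (isog c)" using hess_eq_iff[OF n3 c3 1] by blast
      then show ?thesis using False 1 by (simp add: conj_def)
    qed
    ultimately show ?thesis using c3 by auto
  qed
  \<comment> \<open>As cubing is injective, such a \<open>c\<close> is a fixed point of the
    involution with \<open>2 - c = c\<close>.\<close>
  have conj_self: "(2::'a) = 0 \<and> c = 0" if "conj c = c ^ 3" "c \<noteq> 1" for c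
  proof (cases "c ^ 2 - 2 * c - 2 = 0")
    case True
    then have "(2 - c) ^ 3 = c ^ 3" using that by (simp add: conj_def)
    then have "2 - c = c" by (rule cube_inj)
    moreover have "2 * (1 - c) = (2 - c) - c" by algebra
    ultimately have "2 * (1 - c) = 0" by simp
    then have "(2::'a) = 0" using that(2) by simp
    then show ?thesis using True by simp
  next
    case False
    then have "((c + 2) / (c - 1)) ^ 3 = c ^ 3" using that by (simp add: conj_def isog_def)
    then have "(c + 2) / (c - 1) = c" by (rule cube_inj)
    then have "c + 2 = c * (c - 1)" using that(2) by (simp add: field_simps)
    then have "c ^ 2 - 2 * c - 2 = 0" by algebra
    with False show ?thesis ..
  qed
  have card_fibre: "card {t. t \<noteq> 1 \<and> hess t = hess s} = 2"
    if "s \<noteq> 1" "(2::'a) \<noteq> 0 \<or> s \<noteq> 0" for s :: 'a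
  proof -
    obtain c where c: "s = c ^ 3" using cube by blast
    then have "c \<noteq> 1" using that(1) by auto
    moreover from this have "conj c \<noteq> c ^ 3" using that(2) conj_self[of c] c by auto
    ultimately show ?thesis using fibre[of c] c by auto
  qed
  have q: "card (UNIV :: 'a set) = card (UNIV - {1::'a}) + 1"
    using card_Suc_Diff1[of "UNIV :: 'a set" 1] by simp
  show ?thesis
  proof (cases "(2::'a) = 0")
    case False
    have "card (UNIV - {1::'a}) = 2 * card (hess ` (UNIV - {1::'a}))"
    proof (rule card_eq_mult_card_image)
      fix s :: 'a assume "s \<in> UNIV - {1}"
      then show "card {t \<in> UNIV - {1}. hess t = hess s} = 2"
        using card_fibre[of s] False by simp
    qed simp
    then show ?thesis using q by linarith
  next
    case True
    have "(8::'a) = 2 * 4" by simp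
    then have "(8::'a) = 0" using True by (metis mult_zero_left)
    then have h0: "hess s = hess 0 \<longleftrightarrow> s = 0" if "s \<noteq> 1" for s :: 'a
      using hess_eq_0_iff[OF n3 that] hess_eq_0_iff[OF n3, of 0] by simp
    \<comment> \<open>Outside the one-point fibre of 0 there are \<open>q - 2\<close> points in
      pairs, so the count is \<open>1 + (q - 2) div 2\<close>.\<close>
    define B where "B = UNIV - {1, 0 :: 'a}"
    have h0_B: "hess 0 \<noteq> hess s" if "s \<in> B" for s
      using h0[of s] that by (simp add: B_def)
    have "card B = 2 * card (hess ` B)"
    proof (rule card_eq_mult_card_image)
      fix s assume s: "s \<in> B"
      then have "{t \<in> B. hess t = hess s} = {t. t \<noteq> 1 \<and> hess t = hess s}"
        using h0_B[OF s] by (auto simp: B_def)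
      then show "card {t \<in> B. hess t = hess s} = 2" using card_fibre s by (simp add: B_def)
    qed simp
    moreover have S: "UNIV - {1} = insert 0 B" "0 \<notin> B" by (auto simp: B_def)
    moreover have "hess 0 \<notin> hess ` B" using h0_B by blast
    ultimately show ?thesis unfolding q S(1) by simp
  qed
qed

section \<open>Case distinction by the residue of \<open>q\<close> modulo 3\<close>

theorem mainTheorem15:
  fixes q :: nat
  assumes "q = card (UNIV :: ('a::{finite,field}) set)"
  shows "J_GH TYPE('a) =
    (if q mod 3 = 0 then q - 1
     else if q mod 3 = 1 then (3 * q + 1) div 4
     else q div 2)"
proof -
  define W where "W = {x::'a. x ^ 2 + x + 1 = 0}"
  have q: "(q + 1) mod 3 = card W mod 3"
    using card_mod_3_eq_card_roots[where 'a='a] assms by (simp add: W_def)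
  have W: "W = {w, - 1 - w}" if "w \<in> W" for w
  proof -
    have w: "w ^ 2 + w + 1 = 0" using that by (simp add: W_def)
    have "x ^ 2 + x + 1 = (x - w) * (x - (- 1 - w))" for x using w by algebra
    then show ?thesis by (auto simp: W_def)
  qed
  \<comment> \<open>The three cases have 1, 2 and 0 roots, so \<open>q\<close> is 0, 1 and 2 modulo
    3.\<close>
  consider "(3::'a) = 0" | w where "(3::'a) \<noteq> 0" "w \<in> W" | "W = {}" by blast
  then show ?thesis
  proof cases
    case 1
    then have "1 \<in> W" by (simp add: W_def)
    moreover have "- 1 - 1 = (1::'a)"
    proof -
      have "1 - (- 1 - 1) = (3::'a)" by simp
      then show ?thesis using 1 by (metis eq_iff_diff_eq_0)
    qed
    ultimately have "W = {1}" using W by fastforce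
    then have "q mod 3 = 0" using q by (simp add: mod_Suc split: if_splits)
    then show ?thesis using J_GH_char_3[OF 1] assms by simp
  next
    case 2
    then have w: "w ^ 2 + w + 1 = 0" by (simp add: W_def)
    have "w \<noteq> - 1 - w"
    proof
      assume "w = - 1 - w"
      \<comment> \<open>The squared difference of the two roots is the discriminant -3.\<close>
      moreover have "(3::'a) = 4 * (w ^ 2 + w + 1) - (w - (- 1 - w)) ^ 2" by algebra
      ultimately have "(3::'a) = 0" using w by simp
      with 2 show False by simp
    qed
    then have "card W = 2" using W[OF 2(2)] by simp
    then have "q mod 3 = 1" using q by (simp add: mod_Suc split: if_splits)
    then show ?thesis
      using card_hess_image_if_root[OF 2(1) w] assms
      by (simp add: J_GH_def j_GH_set_eq_hess_image[OF 2(1)])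
  next
    case 3
    then have no_root: "x ^ 2 + x + 1 \<noteq> 0" for x :: 'a by (auto simp: W_def)
    have n3: "(3::'a) \<noteq> 0" using no_root[of 1] by simp
    have "q mod 3 = 2" using q 3 by (simp add: mod_Suc split: if_splits)
    then show ?thesis
      using card_hess_image_if_no_root[OF no_root] assms
      by (simp add: J_GH_def j_GH_set_eq_hess_image[OF n3])
  qed
qed

end
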